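(* Let $n\ge2$, $p\ge1$, and consider the change-point model $\boldsymbol{X}=\boldsymbol{Z}\boldsymbol{\beta}+\boldsymbol{c}_\tau\phi+\boldsymbol{\Gamma}\boldsymbol{\xi}$ with a possible change at an unknown $\tau\in[n-1]$, where $\boldsymbol{Z}$ is a known $n\times p$ covariate matrix, $\boldsymbol{c}_\tau\in\mathbb{R}^n$ is a known vector of covariates specific to a change at $\tau$, $\boldsymbol{\beta}\in\mathbb{R}^p$ and $\phi\in\mathbb{R}$ are unknown parameters, $\boldsymbol{\Gamma}$ is a known invertible $n\times n$ matrix and $\boldsymbol{\xi}\sim N_n(0,I_n)$. Then there is an $h^*\in\mathcal{H}_{1,2n-2}$ equivalent to the likelihood-ratio test (over unknown $\tau\in[n-1]$) for testing $\phi=0$ against $\phi\neq0$, i.e. $h^*(\boldsymbol{x})=1$ exactly when this likelihood-ratio test rejects.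
   Context: Neural network classes: for $L\ge1$ and widths $\boldsymbol{m}=(m_1,\ldots,m_L)$, set $m_0=n$, $m_{L+1}=1$; for $\boldsymbol{b}\in\mathbb{R}^r$ let $\sigma_{\boldsymbol{b}}(y_1,\ldots,y_r)=(\max(y_1-b_1,0),\ldots,\max(y_r-b_r,0))$. $\mathcal{H}_{L,\boldsymbol{m}}$ is the class of all functions $h:\mathbb{R}^n\to\{0,1\}$ of the form $h(\boldsymbol{x})=\sigma^*_\lambda W_L\sigma_{\boldsymbol{b}_L}\cdots W_1\sigma_{\boldsymbol{b}_1}W_0\boldsymbol{x}$, where $\sigma^*_\lambda(x)=\mathbb{1}\{x>\lambda\}$ with $\lambda>0$, $W_\ell\in\mathbb{R}^{m_{\ell+1}\times m_\ell}$, $\boldsymbol{b}_\ell\in\mathbb{R}^{m_\ell}$. $\mathcal{H}_{1,m}$ denotes the class with one hidden layer of width $m$. *)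

theory Defs
  imports "HOL-Analysis.Analysis"
begin

text \<open>The class H_{1,m}: one hidden ReLU layer of width m, inputs in R^n (n = CARD('n)).
  h(x) = sigma*_lambda W_1 sigma_b W_0 x, with rows W0 j of W_0 (j < m), b the bias vector,
  W1 the output weights, lambda > 0. Output 1/0 as a real number.\<close>
definition relu_net1 :: "nat \<Rightarrow> (real^'n \<Rightarrow> real) set" where
  "relu_net1 m = {h. \<exists>(W0 :: nat \<Rightarrow> real^'n) (b :: nat \<Rightarrow> real) (W1 :: nat \<Rightarrow> real) (lam :: real).
      lam > 0 \<and>
      (\<forall>x. h x = (if (\<Sum>j<m. W1 j * max ((W0 j) \<bullet> x - b j) 0) > lam then 1 else 0))}"

text \<open>Density at x of X = mu + Gamma xi with xi ~ N_n(0, I_n), Gamma invertible: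
  phi_n(Gamma^{-1}(x - mu)) / |det Gamma|.\<close>
definition gauss_lik :: "real^'n^'n \<Rightarrow> real^'n \<Rightarrow> real^'n \<Rightarrow> real" where
  "gauss_lik Gam mu x =
     (2 * pi) powr (- real CARD('n) / 2) / \<bar>det Gam\<bar> *
     exp (- (norm (matrix_inv Gam *v (x - mu)))\<^sup>2 / 2)"

text \<open>Likelihood ratio for H0: phi = 0 vs H1: phi \<noteq> 0 (tau \<in> [n-1] unknown) in the model
  X = Z beta + c_tau phi + Gamma xi.\<close>
definition cp_LR :: "real^'p^'n \<Rightarrow> (nat \<Rightarrow> real^'n) \<Rightarrow> real^'n^'n \<Rightarrow> real^'n \<Rightarrow> real" where
  "cp_LR Z c Gam x =
     Sup {gauss_lik Gam (Z *v beta + phi *\<^sub>R c tau) x | tau beta phi.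
            tau \<in> {1..CARD('n) - 1} \<and> phi \<noteq> 0}
   / Sup {gauss_lik Gam (Z *v beta) x | beta. True}"

end

theory Submission
  imports Defs
begin

text \<open>After whitening, \<open>y = \<Gamma>\<^sup>-\<^sup>1x\<close> follows \<open>y = W\<beta> + \<phi> \<Gamma>\<^sup>-\<^sup>1c\<^sub>\<tau> + \<xi>\<close> with
  \<open>W = \<Gamma>\<^sup>-\<^sup>1Z\<close>. Maximising over \<open>\<beta>\<close> leaves the least-squares residual \<open>r\<close> of \<open>y\<close> on the
  column space of \<open>W\<close>; maximising over \<open>\<phi>\<close> then removes from \<open>\<parallel>r\<parallel>\<^sup>2\<close> the squared
  component of \<open>r\<close> along the unit residual direction \<open>a\<^sub>\<tau>\<close> of \<open>\<Gamma>\<^sup>-\<^sup>1c\<^sub>\<tau>\<close>. So the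
  likelihood ratio is \<open>exp (max\<^sub>\<tau> (a\<^sub>\<tau> \<bullet> y)\<^sup>2 / 2)\<close>, and the test rejects iff
  \<open>\<bar>a\<^sub>\<tau> \<bullet> y\<bar> > sqrt (2 ln C)\<close> for some \<open>\<tau>\<close> (always, if \<open>C < 1\<close>). Each condition
  \<open>\<bar>b \<bullet> x\<bar> > t\<close> is the positivity of the ReLU pair \<open>max (b \<bullet> x - t) 0 + max (- b \<bullet> x - t) 0\<close>,
  so \<open>n - 1\<close> pairs of hidden units suffice.\<close>

definition orth_resid :: "'a::euclidean_space set \<Rightarrow> 'a \<Rightarrow> 'a" where
  "orth_resid S x = (SOME z. x - z \<in> span S \<and> (\<forall>w\<in>span S. orthogonal z w))"

lemma orth_resid:
  "x - orth_resid S x \<in> span S" "w \<in> span S \<Longrightarrow> orthogonal (orth_resid S x) w"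
proof -
  obtain y z where "y \<in> span S" "\<And>w. w \<in> span S \<Longrightarrow> orthogonal z w" "x = y + z"
    by (blast intro: orthogonal_subspace_decomp_exists [of S x])
  then have "\<exists>z. x - z \<in> span S \<and> (\<forall>w\<in>span S. orthogonal z w)"
    by (metis add_diff_cancel_right')
  from someI_ex [OF this]
  show "x - orth_resid S x \<in> span S" "w \<in> span S \<Longrightarrow> orthogonal (orth_resid S x) w"
    unfolding orth_resid_def by blast+
qed

lemma orth_resid_unique:
  assumes "x - z \<in> span S" and "\<And>w. w \<in> span S \<Longrightarrow> orthogonal z w"
  shows "orth_resid S x = z"
proof -
  have "z - orth_resid S x = (x - orth_resid S x) - (x - z)" by simp
  then have "z - orth_resid S x \<in> span S"
    using orth_resid(1) assms(1) by (metis span_diff)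
  then have "orthogonal (z - orth_resid S x) (z - orth_resid S x)"
    using assms(2) orth_resid(2) by (simp add: orthogonal_def inner_diff_left)
  then show ?thesis by (simp add: orthogonal_def)
qed

lemma orth_resid_diff_scaleR:
  "orth_resid S (x - c *\<^sub>R y) = orth_resid S x - c *\<^sub>R orth_resid S y"
proof (rule orth_resid_unique)
  have "x - c *\<^sub>R y - (orth_resid S x - c *\<^sub>R orth_resid S y)
      = (x - orth_resid S x) - c *\<^sub>R (y - orth_resid S y)"
    by (simp add: algebra_simps)
  then show "x - c *\<^sub>R y - (orth_resid S x - c *\<^sub>R orth_resid S y) \<in> span S"
    by (simp only: span_diff span_scale orth_resid(1))
  show "orthogonal (orth_resid S x - c *\<^sub>R orth_resid S y) w" if "w \<in> span S" for w
    using orth_resid(2) [OF that] by (simp add: orthogonal_def inner_diff_left)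
qed

lemma inner_orth_resid_eq: "x \<bullet> orth_resid S y = orth_resid S x \<bullet> orth_resid S y"
proof -
  have "(x - orth_resid S x) \<bullet> orth_resid S y = 0"
    using orth_resid(2) [OF orth_resid(1)] by (simp add: orthogonal_def inner_commute)
  then show ?thesis by (simp add: inner_diff_left)
qed

lemma norm_orth_resid_le:
  assumes "w \<in> span S"
  shows "norm (orth_resid S x) \<le> norm (x - w)"
proof -
  have "x - w = (x - orth_resid S x - w) + orth_resid S x" by simp
  moreover have "orthogonal (x - orth_resid S x - w) (orth_resid S x)"
    using orth_resid(2) [OF span_diff [OF orth_resid(1) assms]] by (simp add: orthogonal_commute)
  ultimately have "(norm (x - w))\<^sup>2 = (norm (x - orth_resid S x - w))\<^sup>2 + (norm (orth_resid S x))\<^sup>2"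
    by (metis norm_add_Pythagorean)
  then show ?thesis by (simp add: power2_le_imp_le)
qed

lemma norm_diff_scaleR_sq:
  fixes r d :: "'a::real_inner"
  shows "(norm (r - t *\<^sub>R d))\<^sup>2 = (norm r)\<^sup>2 - (r \<bullet> sgn d)\<^sup>2 + (t * norm d - r \<bullet> sgn d)\<^sup>2"
proof (cases "d = 0")
  case False
  have "(norm (r - t *\<^sub>R d))\<^sup>2 = (norm r)\<^sup>2 - 2 * t * (r \<bullet> d) + t\<^sup>2 * (norm d)\<^sup>2"
    unfolding power2_norm_eq_inner
    by (simp add: inner_diff_left inner_diff_right inner_commute power2_eq_square algebra_simps)
  moreover have "r \<bullet> sgn d = (r \<bullet> d) / norm d"
    by (simp add: sgn_div_norm divide_inverse)
  ultimately show ?thesis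
    using False by (simp add: power2_eq_square field_simps)
qed simp

lemma isCont_le_of_punctured_le:
  fixes g :: "real \<Rightarrow> real"
  assumes "isCont g x" and "\<And>y. y \<noteq> x \<Longrightarrow> g y \<le> u"
  shows "g x \<le> u"
  by (rule tendsto_upperbound [OF assms(1) [unfolded isCont_def]])
     (auto simp: eventually_at_filter assms(2))

lemma norm_orth_resid_range_le: "norm (orth_resid (range L) y) \<le> norm (y - L b)"
  by (rule norm_orth_resid_le) (simp add: span_base)

lemma orth_resid_range_attained:
  assumes "linear L"
  obtains b where "y - L b = orth_resid (range L) y"
proof -
  have "span (range L) = range L"
    using linear_subspace_image [OF assms subspace_UNIV] by simp
  then obtain b where "L b = y - orth_resid (range L) y"
    using orth_resid(1) by (metis imageE)
  then show ?thesis by (intro that [of b]) simp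
qed

lemma Sup_gauss_range:
  fixes L :: "'b::real_vector \<Rightarrow> 'a::euclidean_space"
  assumes "linear L" and "K > 0"
  shows "Sup {K * exp (- (norm (y - L b))\<^sup>2 / 2) | b. True}
       = K * exp (- (norm (orth_resid (range L) y))\<^sup>2 / 2)"
proof (rule cSup_eq_maximum)
  obtain b where "y - L b = orth_resid (range L) y"
    using orth_resid_range_attained [OF assms(1)] .
  then show "K * exp (- (norm (orth_resid (range L) y))\<^sup>2 / 2)
      \<in> {K * exp (- (norm (y - L b))\<^sup>2 / 2) | b. True}"
    by (metis (mono_tags, lifting) mem_Collect_eq)
next
  fix v assume "v \<in> {K * exp (- (norm (y - L b))\<^sup>2 / 2) | b. True}"
  then obtain b where v: "v = K * exp (- (norm (y - L b))\<^sup>2 / 2)" by blast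
  have "(norm (orth_resid (range L) y))\<^sup>2 \<le> (norm (y - L b))\<^sup>2"
    by (simp add: norm_orth_resid_range_le power_mono)
  then show "v \<le> K * exp (- (norm (orth_resid (range L) y))\<^sup>2 / 2)"
    unfolding v using assms(2) by simp
qed

lemma Sup_gauss_range_shift:
  fixes L :: "'b::real_vector \<Rightarrow> 'a::euclidean_space" and e :: "'i \<Rightarrow> 'a"
  assumes "linear L" and "K > 0" and "finite T" and "T \<noteq> {}"
  shows "Sup {K * exp (- (norm (y - L b - t *\<^sub>R e i))\<^sup>2 / 2) | i b t. i \<in> T \<and> t \<noteq> 0}
       = K * exp (- ((norm (orth_resid (range L) y))\<^sup>2
                     - Max ((\<lambda>i. (y \<bullet> sgn (orth_resid (range L) (e i)))\<^sup>2) ` T)) / 2)"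
    (is "Sup ?A = K * exp (- ((norm ?r)\<^sup>2 - ?S) / 2)")
proof -
  define d where "d i = orth_resid (range L) (e i)" for i
  have resid_shift: "orth_resid (range L) (y - t *\<^sub>R e i) = ?r - t *\<^sub>R d i" for t i
    unfolding d_def by (rule orth_resid_diff_scaleR)
  have y_sgn: "y \<bullet> sgn (d i) = ?r \<bullet> sgn (d i)" for i
    unfolding d_def sgn_div_norm inner_scaleR_right inner_orth_resid_eq [of y] ..
  show ?thesis
  proof (rule cSup_eq_non_empty)
    obtain i where "i \<in> T" using assms(4) by blast
    then have "K * exp (- (norm (y - L 0 - 1 *\<^sub>R e i))\<^sup>2 / 2) \<in> ?A" by fastforce
    then show "?A \<noteq> {}" by blast
  next
    fix v assume "v \<in> ?A"
    then obtain i b t where i: "i \<in> T" and v: "v = K * exp (- (norm (y - L b - t *\<^sub>R e i))\<^sup>2 / 2)"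
      by blast
    have "(norm ?r)\<^sup>2 - ?S \<le> (norm ?r)\<^sup>2 - (?r \<bullet> sgn (d i))\<^sup>2"
      using i assms(3) y_sgn unfolding d_def by simp
    also have "\<dots> \<le> (norm (?r - t *\<^sub>R d i))\<^sup>2"
      by (simp add: norm_diff_scaleR_sq)
    also have "\<dots> \<le> (norm (y - L b - t *\<^sub>R e i))\<^sup>2"
    proof -
      have "y - L b - t *\<^sub>R e i = (y - t *\<^sub>R e i) - L b" by simp
      then show ?thesis
        using norm_orth_resid_range_le [of L "y - t *\<^sub>R e i" b]
        by (simp only: resid_shift power_mono norm_ge_zero)
    qed
    finally show "v \<le> K * exp (- ((norm ?r)\<^sup>2 - ?S) / 2)"
      unfolding v using assms(2) by simp
  next
    fix u assume ub: "\<And>v. v \<in> ?A \<Longrightarrow> v \<le> u"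
    txt \<open>The constraint \<open>t \<noteq> 0\<close> costs nothing: the profile in \<open>t\<close> is continuous.\<close>
    have "?S \<in> (\<lambda>i. (y \<bullet> sgn (d i))\<^sup>2) ` T"
      unfolding d_def using assms(3,4) by (intro Max_in) auto
    then obtain i where i: "i \<in> T" and S: "?S = (?r \<bullet> sgn (d i))\<^sup>2"
      using y_sgn by auto
    define g where "g t = K * exp (- (norm (?r - t *\<^sub>R d i))\<^sup>2 / 2)" for t
    have g_le: "g t \<le> u" if "t \<noteq> 0" for t
    proof -
      obtain b where "y - t *\<^sub>R e i - L b = orth_resid (range L) (y - t *\<^sub>R e i)"
        using orth_resid_range_attained [OF assms(1)] .
      then have "y - L b - t *\<^sub>R e i = ?r - t *\<^sub>R d i"
        by (simp add: resid_shift algebra_simps)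
      moreover have "K * exp (- (norm (y - L b - t *\<^sub>R e i))\<^sup>2 / 2) \<in> ?A"
        using i that by fastforce
      ultimately have "g t \<in> ?A"
        unfolding g_def by simp
      then show ?thesis by (rule ub)
    qed
    have "isCont g 0"
      unfolding g_def by (intro continuous_intros) simp
    then have "g 0 \<le> u"
      using g_le by (rule isCont_le_of_punctured_le)
    with g_le have g_all: "g t \<le> u" for t
      by (cases "t = 0") auto
    define t where "t = (?r \<bullet> sgn (d i)) / norm (d i)"
    have "t * norm (d i) = ?r \<bullet> sgn (d i)"
      by (cases "d i = 0") (simp_all add: t_def)
    then have "(norm (?r - t *\<^sub>R d i))\<^sup>2 = (norm ?r)\<^sup>2 - ?S"
      unfolding S norm_diff_scaleR_sq by simp
    with g_all [of t] show "K * exp (- ((norm ?r)\<^sup>2 - ?S) / 2) \<le> u"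
      unfolding g_def by simp
  qed
qed

definition cp_direction :: "real^'p^'n \<Rightarrow> (nat \<Rightarrow> real^'n) \<Rightarrow> real^'n^'n \<Rightarrow> nat \<Rightarrow> real^'n" where
  "cp_direction Z c Gam tau =
     sgn (orth_resid (range ((*v) (matrix_inv Gam ** Z))) (matrix_inv Gam *v c tau)) v* matrix_inv Gam"

lemma cp_LR_eq_exp_Max:
  fixes Z :: "real^'p^'n" and c :: "nat \<Rightarrow> real^'n" and Gam :: "real^'n^'n"
  assumes "invertible Gam" and "CARD('n) \<ge> 2"
  shows "cp_LR Z c Gam x
       = exp (Max ((\<lambda>tau. (cp_direction Z c Gam tau \<bullet> x)\<^sup>2) ` {1..CARD('n) - 1}) / 2)"
proof -
  define M where "M = matrix_inv Gam"
  define L where "L = (*v) (M ** Z)"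
  define K where "K = (2 * pi) powr (- real CARD('n) / 2) / \<bar>det Gam\<bar>"
  define T where "T = {1..CARD('n) - 1}"
  define R where "R = (norm (orth_resid (range L) (M *v x)))\<^sup>2"
  define S where "S = Max ((\<lambda>tau. (cp_direction Z c Gam tau \<bullet> x)\<^sup>2) ` T)"
  have "linear L"
    unfolding L_def by simp
  have "K > 0"
    using assms(1) invertible_det_nz [of Gam] unfolding K_def by simp
  have "finite T" "T \<noteq> {}"
    using assms(2) unfolding T_def by auto
  have lik: "gauss_lik Gam mu x = K * exp (- (norm (M *v x - M *v mu))\<^sup>2 / 2)" for mu
    unfolding gauss_lik_def K_def M_def by (simp add: matrix_vector_mult_diff_distrib)
  have dir: "cp_direction Z c Gam tau \<bullet> x = (M *v x) \<bullet> sgn (orth_resid (range L) (M *v c tau))" for tau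
    unfolding cp_direction_def dot_lmul_matrix M_def L_def by (simp add: inner_commute)
  have "Sup {gauss_lik Gam (Z *v beta) x | beta. True}
      = Sup {K * exp (- (norm (M *v x - L beta))\<^sup>2 / 2) | beta. True}"
    unfolding lik L_def by (simp add: matrix_vector_mul_assoc)
  also have "\<dots> = K * exp (- R / 2)"
    unfolding R_def using \<open>linear L\<close> \<open>K > 0\<close> by (rule Sup_gauss_range)
  finally have null: "Sup {gauss_lik Gam (Z *v beta) x | beta. True} = K * exp (- R / 2)" .
  have "Sup {gauss_lik Gam (Z *v beta + phi *\<^sub>R c tau) x | tau beta phi. tau \<in> T \<and> phi \<noteq> 0}
      = Sup {K * exp (- (norm (M *v x - L beta - phi *\<^sub>R (M *v c tau)))\<^sup>2 / 2)
             | tau beta phi. tau \<in> T \<and> phi \<noteq> 0}"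
    unfolding lik L_def
    by (simp add: matrix_vector_mul_assoc matrix_vector_right_distrib matrix_vector_mult_scaleR
        diff_diff_eq)
  also have "\<dots> = K * exp (- (R - S) / 2)"
    unfolding R_def S_def dir using \<open>linear L\<close> \<open>K > 0\<close> \<open>finite T\<close> \<open>T \<noteq> {}\<close>
    by (rule Sup_gauss_range_shift)
  finally have alt: "Sup {gauss_lik Gam (Z *v beta + phi *\<^sub>R c tau) x | tau beta phi.
      tau \<in> T \<and> phi \<noteq> 0} = K * exp (- (R - S) / 2)" .
  have "cp_LR Z c Gam x = K * exp (- (R - S) / 2) / (K * exp (- R / 2))"
    unfolding cp_LR_def null alt [unfolded T_def] ..
  also have "\<dots> = exp (S / 2)"
    using \<open>K > 0\<close> by (simp add: exp_diff [symmetric] diff_divide_distrib)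
  finally show ?thesis
    unfolding S_def T_def .
qed

lemma sum_lessThan_double: "(\<Sum>j<2 * (k::nat). f j) = (\<Sum>i<k. f (2 * i) + f (2 * i + 1))"
  by (induction k) (simp_all add: ac_simps)

lemma relu_pair_eq_abs:
  fixes u t :: real
  assumes "0 \<le> t"
  shows "max (u - t) 0 + max (- u - t) 0 = max (\<bar>u\<bar> - t) 0"
  using assms by (simp add: max_def abs_if)

text \<open>The output unit needs a threshold \<open>\<lambda> > 0\<close>; one pair of hidden units supplies it as a
  constant offset on top of its own threshold test (for \<open>t = 0\<close> this needs unequal weights).\<close>

lemma relu_pair_abs_threshold:
  fixes t :: real
  assumes "0 \<le> t"
  shows "\<exists>w1 c1 w2 c2 lam. 0 < lam \<and>
    (\<forall>u. lam \<le> w1 * max (u - c1) 0 + w2 * max (- u - c2) 0 \<and>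
         (lam < w1 * max (u - c1) 0 + w2 * max (- u - c2) 0 \<longleftrightarrow> t < \<bar>u\<bar>))"
proof (cases "t = 0")
  case True
  have "\<forall>u. 1 \<le> 2 * max u 0 + max (- u + 1) 0 \<and>
      (1 < 2 * max u 0 + max (- u + 1) 0 \<longleftrightarrow> t < \<bar>u\<bar>)"
    using True by (simp add: max_def abs_if)
  then show ?thesis
    by (intro exI [of _ 2] exI [of _ 0] exI [of _ 1] exI [of _ "-1"] exI [of _ 1]) simp
next
  case False
  have "max (u + t) 0 + max (- u + t) 0 = 2 * t + max (\<bar>u\<bar> - t) 0" for u
    using assms by (simp add: max_def abs_if)
  then have "\<forall>u. 2 * t \<le> max (u + t) 0 + max (- u + t) 0 \<and>
      (2 * t < max (u + t) 0 + max (- u + t) 0 \<longleftrightarrow> t < \<bar>u\<bar>)"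
    by (simp add: less_max_iff_disj)
  then show ?thesis
    using assms False
    by (intro exI [of _ 1] exI [of _ "-t"] exI [of _ 1] exI [of _ "-t"] exI [of _ "2 * t"]) simp
qed

lemma relu_net1_const_one:
  assumes "1 \<le> m"
  shows "(\<lambda>_. 1) \<in> relu_net1 m"
  unfolding relu_net1_def
  by (intro CollectI exI [of _ "\<lambda>_. 0"] exI [of _ "\<lambda>_. -1"] exI [of _ "\<lambda>_. 1"] exI [of _ "1/2"])
     (use assms in simp)

lemma relu_net1_abs_threshold:
  fixes a :: "nat \<Rightarrow> real^'n" and t :: real and k :: nat
  assumes "0 \<le> t" and "1 \<le> k"
  shows "(\<lambda>x. if \<exists>i<k. t < \<bar>a i \<bullet> x\<bar> then 1 else 0) \<in> relu_net1 (2 * k)"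
proof -
  obtain w1 w2 c1 c2 lam where "0 < lam"
    and pair_ge: "\<And>u. lam \<le> w1 * max (u - c1) 0 + w2 * max (- u - c2) 0"
    and pair_gt: "\<And>u. lam < w1 * max (u - c1) 0 + w2 * max (- u - c2) 0 \<longleftrightarrow> t < \<bar>u\<bar>"
    using relu_pair_abs_threshold [OF assms(1)] by metis
  define W0 where "W0 j = (if even j then a (j div 2) else - a (j div 2))" for j :: nat
  define b where "b j = (if j = 0 then c1 else if j = 1 then c2 else t)" for j :: nat
  define W1 where "W1 j = (if j = 0 then w1 else if j = 1 then w2 else 1)" for j :: nat
  have "lam < (\<Sum>j<2 * k. W1 j * max (W0 j \<bullet> x - b j) 0) \<longleftrightarrow> (\<exists>i<k. t < \<bar>a i \<bullet> x\<bar>)" for x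
  proof -
    define e where "e i = W1 (2 * i) * max (W0 (2 * i) \<bullet> x - b (2 * i)) 0
      + W1 (2 * i + 1) * max (W0 (2 * i + 1) \<bullet> x - b (2 * i + 1)) 0 - (if i = 0 then lam else 0)"
      for i
    have e: "0 \<le> e i \<and> (0 < e i \<longleftrightarrow> t < \<bar>a i \<bullet> x\<bar>)" for i
    proof (cases "i = 0")
      case True
      then show ?thesis
        using pair_ge [of "a 0 \<bullet> x"] pair_gt [of "a 0 \<bullet> x"] by (simp add: e_def W0_def W1_def b_def)
    next
      case False
      then show ?thesis
        using relu_pair_eq_abs [OF assms(1), of "a i \<bullet> x"]
        by (simp add: e_def W0_def W1_def b_def less_max_iff_disj)
    qed
    have "(\<Sum>j<2 * k. W1 j * max (W0 j \<bullet> x - b j) 0) - lam = (\<Sum>i<k. e i)"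
      using assms(2) by (simp add: sum_lessThan_double e_def sum_subtractf sum.delta)
    moreover have "0 < (\<Sum>i<k. e i) \<longleftrightarrow> (\<exists>i<k. 0 < e i)"
      using e sum_nonneg_eq_0_iff [of "{..<k}" e] sum_nonneg [of "{..<k}" e]
      by (auto simp: order_less_le)
    ultimately show ?thesis
      using e by auto
  qed
  then show ?thesis
    unfolding relu_net1_def mem_Collect_eq using \<open>0 < lam\<close>
    by (intro exI [of _ W0] exI [of _ b] exI [of _ W1] exI [of _ lam]) simp
qed

lemma one_le_cp_LR:
  fixes Z :: "real^'p^'n" and c :: "nat \<Rightarrow> real^'n" and Gam :: "real^'n^'n"
  assumes "invertible Gam" and "CARD('n) \<ge> 2"
  shows "1 \<le> cp_LR Z c Gam x"
proof -
  have "(cp_direction Z c Gam 1 \<bullet> x)\<^sup>2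
      \<le> Max ((\<lambda>tau. (cp_direction Z c Gam tau \<bullet> x)\<^sup>2) ` {1..CARD('n) - 1})"
    using assms(2) by (intro Max_ge) auto
  then have "0 \<le> Max ((\<lambda>tau. (cp_direction Z c Gam tau \<bullet> x)\<^sup>2) ` {1..CARD('n) - 1})"
    by (meson zero_le_power2 order_trans)
  then show ?thesis
    unfolding cp_LR_eq_exp_Max [OF assms] by simp
qed

lemma cp_LR_gt_iff:
  fixes Z :: "real^'p^'n" and c :: "nat \<Rightarrow> real^'n" and Gam :: "real^'n^'n"
  assumes "invertible Gam" and "CARD('n) \<ge> 2" and "1 \<le> C"
  shows "C < cp_LR Z c Gam x
     \<longleftrightarrow> (\<exists>i<CARD('n) - 1. sqrt (2 * ln C) < \<bar>cp_direction Z c Gam (Suc i) \<bullet> x\<bar>)"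
proof -
  let ?f = "\<lambda>tau. cp_direction Z c Gam tau \<bullet> x"
  have sqrt_less_abs: "sqrt a < \<bar>v\<bar> \<longleftrightarrow> a < v\<^sup>2" for a v :: real
    by (metis real_sqrt_abs real_sqrt_less_iff)
  have less_exp: "C < exp y \<longleftrightarrow> ln C < y" for y
    using assms(3) by (metis exp_less_cancel_iff exp_ln less_le_trans zero_less_one)
  have "C < cp_LR Z c Gam x \<longleftrightarrow> ln C < Max ((\<lambda>tau. (?f tau)\<^sup>2) ` {1..CARD('n) - 1}) / 2"
    unfolding cp_LR_eq_exp_Max [OF assms(1,2)] less_exp ..
  also have "\<dots> \<longleftrightarrow> (\<exists>tau\<in>{1..CARD('n) - 1}. 2 * ln C < (?f tau)\<^sup>2)"
    using assms(2) by (simp add: Max_gr_iff mult.commute)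
  also have "\<dots> \<longleftrightarrow> (\<exists>i<CARD('n) - 1. sqrt (2 * ln C) < \<bar>?f (Suc i)\<bar>)"
    unfolding image_Suc_lessThan [symmetric] sqrt_less_abs by auto
  finally show ?thesis .
qed

theorem lemma3p2:
  fixes Z :: "real^'p^'n" and c :: "nat \<Rightarrow> real^'n" and Gam :: "real^'n^'n" and C :: real
  assumes "CARD('n) \<ge> 2"
    and "invertible Gam"
  shows "\<exists>h \<in> relu_net1 (2 * CARD('n) - 2). \<forall>x. h x = 1 \<longleftrightarrow> cp_LR Z c Gam x > C"
proof (cases "C < 1")
  case True
  then have "C < cp_LR Z c Gam x" for x
    using one_le_cp_LR [OF assms(2,1)] by (meson less_le_trans)
  moreover have "(\<lambda>_. 1) \<in> relu_net1 (2 * CARD('n) - 2)"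
    using assms(1) by (intro relu_net1_const_one) simp
  ultimately show ?thesis
    by auto
next
  case False
  let ?h = "\<lambda>x. if \<exists>i<CARD('n) - 1. sqrt (2 * ln C) < \<bar>cp_direction Z c Gam (Suc i) \<bullet> x\<bar>
    then 1 else (0::real)"
  have "2 * CARD('n) - 2 = 2 * (CARD('n) - 1)"
    by simp
  then have net: "?h \<in> relu_net1 (2 * CARD('n) - 2)"
    using False assms(1) by (simp add: relu_net1_abs_threshold)
  have "?h x = 1 \<longleftrightarrow> C < cp_LR Z c Gam x" for x
    using cp_LR_gt_iff [OF assms(2,1), of C Z c x] False by simp
  then show ?thesis
    by (intro bexI [OF _ net]) blast
qed

end
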